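(* The extended Schrödinger-Virasoro Lie algebra $\widetilde{\mathfrak{sv}}$ is an infinite-dimensional complete Lie algebra.
   Context: The extended Schrödinger-Virasoro Lie algebra $\widetilde{\mathfrak{sv}}$ is the complex Lie algebra with basis $\{L_n, M_n, N_n, Y_{n+\frac12} \mid n\in\mathbb{Z}\}$ and brackets, for all $m,n\in\mathbb{Z}$: $[L_m,L_n]=(n-m)L_{m+n}$, $[M_m,M_n]=0$, $[N_m,N_n]=0$, $[Y_{m+\frac12},Y_{n+\frac12}]=(m-n)M_{m+n+1}$, $[L_m,M_n]=nM_{m+n}$, $[L_m,N_n]=nN_{m+n}$, $[L_m,Y_{n+\frac12}]=\left(n+\frac{1-m}{2}\right)Y_{m+n+\frac12}$, $[N_m,M_n]=2M_{m+n}$, $[N_m,Y_{n+\frac12}]=Y_{m+n+\frac12}$, $[M_m,Y_{n+\frac12}]=0$. A Lie algebra is called complete if its center is zero and all its derivations (linear maps from the algebra to itself satisfying the Leibniz rule) are inner. *)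

theory Defs
  imports Complex_Main "HOL-Library.Poly_Mapping"
begin

locale lie_algebra = vector_space scale
  for scale :: "'k::field \<Rightarrow> 'v::ab_group_add \<Rightarrow> 'v" +
  fixes bracket :: "'v \<Rightarrow> 'v \<Rightarrow> 'v"
  assumes bracket_linear_right: "Vector_Spaces.linear scale scale (\<lambda>y. bracket x y)"
    and bracket_linear_left: "Vector_Spaces.linear scale scale (\<lambda>x. bracket x y)"
    and bracket_self: "bracket x x = 0"
    and jacobi: "bracket x (bracket y z) + bracket y (bracket z x) + bracket z (bracket x y) = 0"
begin

definition center :: "'v set"
  where "center = {x. \<forall>y. bracket x y = 0}"

definition derivation :: "('v \<Rightarrow> 'v) \<Rightarrow> bool"
  where "derivation D \<longleftrightarrow> Vector_Spaces.linear scale scale D \<and>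
    (\<forall>x y. D (bracket x y) = bracket (D x) y + bracket x (D y))"

definition inner_derivation :: "('v \<Rightarrow> 'v) \<Rightarrow> bool"
  where "inner_derivation D \<longleftrightarrow> (\<exists>x. D = (\<lambda>y. bracket x y))"

end

locale complete_lie_algebra = lie_algebra +
  assumes center_trivial: "center = {0}"
    and derivations_inner: "derivation D \<Longrightarrow> inner_derivation D"

definition finite_dim :: "('k::field \<Rightarrow> 'v::ab_group_add \<Rightarrow> 'v) \<Rightarrow> bool"
  where "finite_dim scale \<longleftrightarrow> (\<exists>B. finite B \<and> module.span scale B = UNIV)"


text \<open>The basis vector \<open>Y\<close> with index \<open>n + 1/2\<close> is represented by \<open>Y n\<close>.\<close>

datatype sv_basis = L int | M int | N int | Y int

type_synonym sv = "sv_basis \<Rightarrow>\<^sub>0 complex"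

definition sv_scale :: "complex \<Rightarrow> sv \<Rightarrow> sv"
  where "sv_scale c = Poly_Mapping.map (\<lambda>a. c * a)"

text \<open>The five equations with a minus sign are forced by antisymmetry, and the remaining pairs
  (\<open>M, M\<close>; \<open>N, N\<close>; \<open>M, Y\<close>; \<open>Y, M\<close>) have bracket zero.\<close>

fun basis_bracket :: "sv_basis \<Rightarrow> sv_basis \<Rightarrow> sv" where
  "basis_bracket (L m) (L n) = Poly_Mapping.single (L (m + n)) (of_int (n - m))"
| "basis_bracket (Y m) (Y n) = Poly_Mapping.single (M (m + n + 1)) (of_int (m - n))"
| "basis_bracket (L m) (M n) = Poly_Mapping.single (M (m + n)) (of_int n)"
| "basis_bracket (L m) (N n) = Poly_Mapping.single (N (m + n)) (of_int n)"
| "basis_bracket (L m) (Y n) = Poly_Mapping.single (Y (m + n)) (of_int n + (1 - of_int m) / 2)"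
| "basis_bracket (N m) (M n) = Poly_Mapping.single (M (m + n)) 2"
| "basis_bracket (N m) (Y n) = Poly_Mapping.single (Y (m + n)) 1"
| "basis_bracket (M n) (L m) = - Poly_Mapping.single (M (m + n)) (of_int n)"
| "basis_bracket (N n) (L m) = - Poly_Mapping.single (N (m + n)) (of_int n)"
| "basis_bracket (Y n) (L m) = - Poly_Mapping.single (Y (m + n)) (of_int n + (1 - of_int m) / 2)"
| "basis_bracket (M n) (N m) = - Poly_Mapping.single (M (m + n)) 2"
| "basis_bracket (Y n) (N m) = - Poly_Mapping.single (Y (m + n)) 1"
| "basis_bracket _ _ = 0"

definition sv_bracket :: "sv \<Rightarrow> sv \<Rightarrow> sv"
  where "sv_bracket x y =
    (\<Sum>a\<in>Poly_Mapping.keys x. \<Sum>b\<in>Poly_Mapping.keys y.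
      sv_scale (Poly_Mapping.lookup x a * Poly_Mapping.lookup y b) (basis_bracket a b))"

end

theory Submission imports Defs begin

text \<open>The elements \<open>L 0\<close> and \<open>N 0\<close> commute and act diagonally on the basis, and the joint weight
  \<open>(0, 0)\<close> occurs only on their span. Hence the center lies in that span, where it is easily seen to
  vanish. For a derivation \<open>D\<close>, the relation \<open>D [L 0, N 0] = 0\<close> makes the components of \<open>D (L 0)\<close> and
  \<open>D (N 0)\<close> of nonzero weight those of a single inner derivation; subtracting it and comparing
  diagonal components shows that \<open>D\<close> kills \<open>L 0\<close> and \<open>N 0\<close>, so it preserves all joint weight spaces.
  The latter have dimension at most two, and the Leibniz rule on pairs of basis vectors then
  determines \<open>D\<close> up to two parameters, realised by \<open>ad (L 0)\<close> and \<open>ad (N 0)\<close>.\<close>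

section \<open>The vector space and its basis\<close>

abbreviation basis_vec :: "sv_basis \<Rightarrow> sv" where
  "basis_vec a \<equiv> Poly_Mapping.single a 1"

lemma lookup_sv_scale [simp]: "Poly_Mapping.lookup (sv_scale c x) a = c * Poly_Mapping.lookup x a"
  unfolding sv_scale_def by (simp add: map.rep_eq when_def)

lemma sv_scale_single [simp]: "sv_scale c (Poly_Mapping.single a d) = Poly_Mapping.single a (c * d)"
  by (rule poly_mapping_eqI) (simp add: lookup_single when_def)

interpretation sv: vector_space sv_scale
  by unfold_locales (auto intro!: poly_mapping_eqI simp: lookup_add algebra_simps)

lemma sv_eq_sum_basis:
  "x = (\<Sum>a\<in>Poly_Mapping.keys x. sv_scale (Poly_Mapping.lookup x a) (basis_vec a))"
  by (rule poly_mapping_eqI)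
    (auto simp: lookup_sum lookup_single when_def in_keys_iff if_distrib sum.delta cong: if_cong)

lemma sv_linear_iff:
  "Vector_Spaces.linear sv_scale sv_scale f \<longleftrightarrow>
    (\<forall>x y. f (x + y) = f x + f y) \<and> (\<forall>c x. f (sv_scale c x) = sv_scale c (f x))"
  by (simp add: Vector_Spaces.linear_iff sv.vector_space_axioms)

lemma sv_linear_eqI:
  assumes f: "Vector_Spaces.linear sv_scale sv_scale f"
    and g: "Vector_Spaces.linear sv_scale sv_scale g"
    and eq: "\<And>a. f (basis_vec a) = g (basis_vec a)"
  shows "f = g"
proof
  interpret f: Vector_Spaces.linear sv_scale sv_scale f by fact
  interpret g: Vector_Spaces.linear sv_scale sv_scale g by fact
  fix x
  have "f x = (\<Sum>a\<in>Poly_Mapping.keys x. sv_scale (Poly_Mapping.lookup x a) (f (basis_vec a)))"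
    using arg_cong[OF sv_eq_sum_basis, of f x] unfolding f.sum f.scale .
  moreover have "g x = (\<Sum>a\<in>Poly_Mapping.keys x. sv_scale (Poly_Mapping.lookup x a) (g (basis_vec a)))"
    using arg_cong[OF sv_eq_sum_basis, of g x] unfolding g.sum g.scale .
  ultimately show "f x = g x" by (simp only: eq)
qed

section \<open>Bilinearity and antisymmetry of the bracket\<close>

text \<open>Terms outside the keys have coefficient zero. Additivity needs this freedom:
  \<open>y\<close>, \<open>z\<close> and \<open>y + z\<close> have different keys, so their double
  sums must first be taken over a common index set.\<close>

lemma sv_bracket_superset:
  assumes "finite A" "Poly_Mapping.keys x \<subseteq> A" "finite B" "Poly_Mapping.keys y \<subseteq> B"
  shows "sv_bracket x y = (\<Sum>a\<in>A. \<Sum>b\<in>B.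
    sv_scale (Poly_Mapping.lookup x a * Poly_Mapping.lookup y b) (basis_bracket a b))"
proof -
  have inner: "(\<Sum>b\<in>B. sv_scale (Poly_Mapping.lookup x a * Poly_Mapping.lookup y b) (basis_bracket a b))
      = (\<Sum>b\<in>Poly_Mapping.keys y.
          sv_scale (Poly_Mapping.lookup x a * Poly_Mapping.lookup y b) (basis_bracket a b))" for a
    by (rule sum.mono_neutral_right) (use assms in \<open>auto simp: in_keys_iff\<close>)
  show ?thesis unfolding sv_bracket_def inner
    by (rule sum.mono_neutral_left) (use assms in \<open>auto simp: in_keys_iff\<close>)
qed

lemma basis_bracket_antisym: "basis_bracket b a = - basis_bracket a b"
  by (cases a; cases b) (simp_all add: add.commute minus_diff_commute flip: single_uminus)

lemma sv_bracket_antisym: "sv_bracket y x = - sv_bracket x y"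
  unfolding sv_bracket_def
  by (subst sum.swap, subst basis_bracket_antisym) (simp add: sum_negf mult.commute)

lemma sv_bracket_linear_right: "Vector_Spaces.linear sv_scale sv_scale (sv_bracket x)"
proof (rule sv_linear_iff[THEN iffD2], intro conjI allI)
  fix y z :: sv and c :: complex
  let ?K = "Poly_Mapping.keys y \<union> Poly_Mapping.keys z"
  have K: "finite ?K" "Poly_Mapping.keys (y + z) \<subseteq> ?K"
      "Poly_Mapping.keys (sv_scale c y) \<subseteq> Poly_Mapping.keys y"
    by (auto simp: in_keys_iff lookup_add)
  show "sv_bracket x (y + z) = sv_bracket x y + sv_bracket x z"
    using K by (simp add: sv_bracket_superset[of "Poly_Mapping.keys x" x ?K]
      lookup_add algebra_simps sum.distrib)
  show "sv_bracket x (sv_scale c y) = sv_scale c (sv_bracket x y)"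
    using K by (simp add: sv_bracket_superset[of "Poly_Mapping.keys x" x "Poly_Mapping.keys y"]
       sv.scale_sum_right mult_ac)
qed

lemma sv_bracket_linear_left: "Vector_Spaces.linear sv_scale sv_scale (\<lambda>x. sv_bracket x y)"
  using sv_bracket_linear_right[of y] unfolding sv_linear_iff
  by (metis minus_add_distrib sv_bracket_antisym sv.scale_minus_right)

lemma sv_bracket_single [simp]:
  "sv_bracket (Poly_Mapping.single a c) (Poly_Mapping.single b d) = sv_scale (c * d) (basis_bracket a b)"
  by (subst sv_bracket_superset[of "{a}" _ "{b}"]) simp_all

interpretation sv_right: Vector_Spaces.linear sv_scale sv_scale "sv_bracket x" for x
  by (rule sv_bracket_linear_right)

interpretation sv_left: Vector_Spaces.linear sv_scale sv_scale "\<lambda>x. sv_bracket x y" for y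
  by (rule sv_bracket_linear_left)

lemmas sv_bilinear = sv_left.add sv_right.add sv_left.scale sv_right.scale
  sv_left.neg sv_right.neg sv_left.zero sv_right.zero

section \<open>The Jacobi identity\<close>

definition jacobiator :: "sv \<Rightarrow> sv \<Rightarrow> sv \<Rightarrow> sv" where
  "jacobiator x y z =
    sv_bracket x (sv_bracket y z) + sv_bracket y (sv_bracket z x) + sv_bracket z (sv_bracket x y)"

lemma jacobiator_linear:
  "Vector_Spaces.linear sv_scale sv_scale (\<lambda>x. jacobiator x y z)"
  "Vector_Spaces.linear sv_scale sv_scale (\<lambda>y. jacobiator x y z)"
  "Vector_Spaces.linear sv_scale sv_scale (\<lambda>z. jacobiator x y z)"
  by (simp_all add: jacobiator_def sv_linear_iff sv_bilinear sv.scale_right_distrib ac_simps)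

lemma zero_linear: "Vector_Spaces.linear sv_scale sv_scale (\<lambda>_. 0)"
  by (simp add: sv_linear_iff)

lemma jacobiator_basis: "jacobiator (basis_vec a) (basis_vec b) (basis_vec c) = 0"
  by (cases a; cases b; cases c)
    (simp_all add: jacobiator_def ac_simps field_simps flip: single_add single_uminus)

text \<open>By trilinearity the identity on basis vectors suffices. The arguments are freed one at a
  time, the last one first, by comparing with the zero map through
  \<open>sv_linear_eqI\<close>.\<close>

lemma jacobiator_eq_0: "jacobiator x y z = 0"
proof -
  have "jacobiator (basis_vec a) (basis_vec b) = (\<lambda>_. 0)" for a b
    by (rule sv_linear_eqI[OF jacobiator_linear(3) zero_linear jacobiator_basis])
  hence "(\<lambda>y. jacobiator (basis_vec a) y z) = (\<lambda>_. 0)" for a z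
    by (intro sv_linear_eqI[OF jacobiator_linear(2) zero_linear]) (simp add: fun_eq_iff)
  hence "(\<lambda>x. jacobiator x y z) = (\<lambda>_. 0)"
    by (intro sv_linear_eqI[OF jacobiator_linear(1) zero_linear]) (simp add: fun_eq_iff)
  thus ?thesis by (simp add: fun_eq_iff)
qed

interpretation sv: lie_algebra sv_scale sv_bracket
proof (intro lie_algebra.intro lie_algebra_axioms.intro)
  show "vector_space sv_scale" by (fact sv.vector_space_axioms)
  show "Vector_Spaces.linear sv_scale sv_scale (sv_bracket x)"
    and "Vector_Spaces.linear sv_scale sv_scale (\<lambda>x. sv_bracket x y)" for x y
    by (fact sv_bracket_linear_right sv_bracket_linear_left)+
  show "sv_bracket x x = 0" for x
  proof (rule poly_mapping_eqI)
    show "Poly_Mapping.lookup (sv_bracket x x) a = Poly_Mapping.lookup 0 a" for a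
      \<comment> \<open>Antisymmetry makes each coefficient equal to its own negative, hence zero
        over the complex numbers.\<close>
      using arg_cong[OF sv_bracket_antisym[of x x], of "\<lambda>x. Poly_Mapping.lookup x a"] by simp
  qed
  show "sv_bracket x (sv_bracket y z) + sv_bracket y (sv_bracket z x) + sv_bracket z (sv_bracket x y) = 0"
    for x y z
    using jacobiator_eq_0 unfolding jacobiator_def .
qed

section \<open>Weights with respect to \<open>L 0\<close> and \<open>N 0\<close>\<close>

text \<open>These are the eigenvalues of \<open>L 0\<close> acting by the bracket. The shift by 1/2
  for \<open>Y n\<close> reflects that it stands for the index n + 1/2.\<close>

fun weight_L :: "sv_basis \<Rightarrow> complex" where
  "weight_L (L n) = of_int n"
| "weight_L (M n) = of_int n"
| "weight_L (N n) = of_int n"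
| "weight_L (Y n) = of_int n + 1 / 2"

fun weight_N :: "sv_basis \<Rightarrow> complex" where
  "weight_N (L n) = 0"
| "weight_N (M n) = 2"
| "weight_N (N n) = 0"
| "weight_N (Y n) = 1"

lemma basis_bracket_Cartan:
  "basis_bracket (L 0) a = Poly_Mapping.single a (weight_L a)"
  "basis_bracket (N 0) a = Poly_Mapping.single a (weight_N a)"
  by (cases a; simp)+

text \<open>Stated for any \<open>h\<close> that acts diagonally with eigenvalues \<open>w\<close>,
  so that it covers \<open>L 0\<close> and \<open>N 0\<close> alike.\<close>

lemma lookup_bracket_diag:
  assumes "\<And>a. basis_bracket h a = Poly_Mapping.single a (w a)"
  shows "Poly_Mapping.lookup (sv_bracket (basis_vec h) x) a = w a * Poly_Mapping.lookup x a"
proof -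
  have "sv_bracket (basis_vec h) x =
      (\<Sum>b\<in>Poly_Mapping.keys x. Poly_Mapping.single b (Poly_Mapping.lookup x b * w b))"
    by (subst sv_bracket_superset[of "{h}" _ "Poly_Mapping.keys x"]) (simp_all add: assms)
  thus ?thesis
    by (auto simp: lookup_sum lookup_single when_def in_keys_iff)
qed

lemmas lookup_bracket_L0 = lookup_bracket_diag[OF basis_bracket_Cartan(1)]
lemmas lookup_bracket_N0 = lookup_bracket_diag[OF basis_bracket_Cartan(2)]

lemma weights_eq_0: "weight_L a = 0 \<Longrightarrow> weight_N a = 0 \<Longrightarrow> a = L 0 \<or> a = N 0"
  by (cases a) auto


lemma sv_eq_Cartan:
  assumes "\<And>a. weight_L a \<noteq> 0 \<or> weight_N a \<noteq> 0 \<Longrightarrow> Poly_Mapping.lookup x a = 0"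
  obtains p q where "x = Poly_Mapping.single (L 0) p + Poly_Mapping.single (N 0) q"
proof
  show "x = Poly_Mapping.single (L 0) (Poly_Mapping.lookup x (L 0)) +
      Poly_Mapping.single (N 0) (Poly_Mapping.lookup x (N 0))" (is "x = ?y")
  proof (rule poly_mapping_eqI)
    show "Poly_Mapping.lookup x a = Poly_Mapping.lookup ?y a" for a
      using assms[of a] weights_eq_0[of a]
      by (cases "a = L 0 \<or> a = N 0") (auto simp: lookup_add lookup_single when_def)
  qed
qed

lemma sv_bracket_Cartan:
  "sv_bracket (Poly_Mapping.single (L 0) p + Poly_Mapping.single (N 0) q) (basis_vec a) =
    Poly_Mapping.single a (p * weight_L a + q * weight_N a)"
  by (simp add: sv_bilinear basis_bracket_Cartan single_add)

text \<open>The span of \<open>L 0\<close> and \<open>N 0\<close> acts faithfully: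
  \<open>L 1\<close> has weights (1, 0) and \<open>M 0\<close> has weights (0, 2), which isolates
  each coefficient.\<close>

lemma weights_separate:
  assumes "\<And>a. p * weight_L a + q * weight_N a = 0"
  shows "p = 0" "q = 0"
  using assms[of "L 1"] assms[of "M 0"] by auto

section \<open>Trivial center and infinite dimension\<close>

lemma sv_center: "sv.center = {0}"
proof -
  have "x = 0" if c: "\<And>y. sv_bracket x y = 0" for x
  proof -
    have c': "sv_bracket y x = 0" for y
      using c[of y] sv_bracket_antisym[of y x] by simp
    have "Poly_Mapping.lookup x a = 0" if "weight_L a \<noteq> 0 \<or> weight_N a \<noteq> 0" for a
      using that lookup_bracket_L0[of x a] lookup_bracket_N0[of x a] by (auto simp: c')
    from sv_eq_Cartan[OF this] obtain p q
      where x: "x = Poly_Mapping.single (L 0) p + Poly_Mapping.single (N 0) q" .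
    have "p * weight_L a + q * weight_N a = 0" for a
      using c[of "basis_vec a"] unfolding x sv_bracket_Cartan
      by (metis lookup_single_eq lookup_zero)
    from weights_separate[OF this] show ?thesis by (simp add: x)
  qed
  thus ?thesis unfolding sv.center_def by (auto simp: sv_bilinear)
qed

text \<open>A finite set of vectors involves only finitely many basis elements, and the vectors
  supported on these form a subspace. It cannot contain every \<open>L n\<close>.\<close>

lemma sv_infinite_dim: "\<not> finite_dim sv_scale"
proof
  assume "finite_dim sv_scale"
  then obtain B where B: "finite B" "sv.span B = UNIV" unfolding finite_dim_def by auto
  define K where "K = (\<Union>x\<in>B. Poly_Mapping.keys x)"
  have "sv.subspace {x. Poly_Mapping.keys x \<subseteq> K}"
    by (auto simp: sv.subspace_def in_keys_iff subset_iff lookup_add) (metis add_0)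
  moreover have "B \<subseteq> {x. Poly_Mapping.keys x \<subseteq> K}" by (auto simp: K_def)
  ultimately have "basis_vec (L n) \<in> {x. Poly_Mapping.keys x \<subseteq> K}" for n
    using sv.span_minimal B(2) by blast
  hence "range L \<subseteq> K" by auto
  moreover have "finite K" using B(1) by (simp add: K_def)
  moreover have "infinite (range L)" by (simp add: finite_image_iff inj_def)
  ultimately show False using finite_subset by blast
qed

section \<open>Derivations are inner\<close>

lemma derivation_add_scale:
  assumes "sv.derivation D"
  shows "D (x + y) = D x + D y" "D (sv_scale c x) = sv_scale c (D x)" "D 0 = 0" "D (- x) = - D x"
    "D (sv_bracket x y) = sv_bracket (D x) y + sv_bracket x (D y)"
proof -
  interpret D: Vector_Spaces.linear sv_scale sv_scale D
    using assms by (simp add: sv.derivation_def)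
  show "D (x + y) = D x + D y" "D (sv_scale c x) = sv_scale c (D x)" "D 0 = 0" "D (- x) = - D x"
    by (fact D.add D.scale D.zero D.neg)+
  show "D (sv_bracket x y) = sv_bracket (D x) y + sv_bracket x (D y)"
    using assms by (simp add: sv.derivation_def)
qed

text \<open>Homogeneity in the form that simplification needs, since \<open>sv_scale_single\<close>
  absorbs scalars into the coefficient of \<open>single\<close>.\<close>

lemma derivation_single:
  assumes "sv.derivation D"
  shows "D (Poly_Mapping.single a c) = sv_scale c (D (basis_vec a))"
  using derivation_add_scale(2)[OF assms, of c "basis_vec a"] by simp

text \<open>The Jacobi identity says exactly that bracketing with \<open>x\<close> is a derivation,
  and derivations are closed under differences.\<close>

lemma derivation_diff_ad:
  assumes "sv.derivation D"
  shows "sv.derivation (\<lambda>y. D y - sv_bracket x y)"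
proof -
  have "sv_bracket x (sv_bracket y z) = sv_bracket (sv_bracket x y) z + sv_bracket y (sv_bracket x z)" for y z
    using sv.jacobi[of x y z] sv_bracket_antisym[of z x] sv_bracket_antisym[of z "sv_bracket x y"]
    by (simp add: sv_bilinear) (simp add: algebra_simps)
  thus ?thesis
    using derivation_add_scale[OF assms]
    by (simp add: sv.derivation_def sv_linear_iff sv_bilinear sv_left.diff sv_right.diff
      sv.scale_right_diff_distrib)
qed

text \<open>Everything comes from applying \<open>D\<close> to the eigenvector equation for
  \<open>h\<close> and comparing coefficients: the diagonal ones force \<open>D\<close> to kill
  \<open>h\<close>, and then the others show that \<open>D\<close> respects the eigenspaces of
  \<open>h\<close>.\<close>

lemma derivation_diag_weights:
  assumes D: "sv.derivation D"
    and h: "\<And>a. basis_bracket h a = Poly_Mapping.single a (w a)"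
    and zero: "\<And>a. weight_L a \<noteq> 0 \<or> weight_N a \<noteq> 0 \<Longrightarrow>
      Poly_Mapping.lookup (D (basis_vec h)) a = 0"
  shows "D (basis_vec h) = 0"
    and "w a \<noteq> w b \<Longrightarrow>
      Poly_Mapping.lookup (D (basis_vec b)) a = 0"
proof -
  obtain p q where Dh: "D (basis_vec h) = Poly_Mapping.single (L 0) p + Poly_Mapping.single (N 0) q"
    using sv_eq_Cartan[OF zero] by blast
  have eq: "sv_scale (w b) (D (basis_vec b)) =
      Poly_Mapping.single b (p * weight_L b + q * weight_N b) + sv_bracket (basis_vec h) (D (basis_vec b))" for b
    using derivation_add_scale(5)[OF D, of "basis_vec h" "basis_vec b"]
    by (simp add: h Dh sv_bracket_Cartan derivation_single[OF D, of b "w b"])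
  \<comment> \<open>In the coefficient of \<open>b\<close> itself, the left side and the last
    bracket both contribute \<open>w b\<close> times the same number, so they cancel.\<close>
  have "p * weight_L b + q * weight_N b = 0" for b
    using arg_cong[OF eq[of b], of "\<lambda>x. Poly_Mapping.lookup x b"]
    by (simp add: lookup_add lookup_bracket_diag[OF h])
  from weights_separate[OF this] have pq: "p = 0" "q = 0" .
  show "D (basis_vec h) = 0" by (simp add: Dh pq)
  show "w a \<noteq> w b \<Longrightarrow>
      Poly_Mapping.lookup (D (basis_vec b)) a = 0"
    using arg_cong[OF eq[of b], of "\<lambda>x. Poly_Mapping.lookup x a"]
    by (simp add: pq lookup_bracket_diag[OF h])
qed

lemma derivation_normalise:
  assumes D: "sv.derivation D"
  obtains x where
    "\<And>a. weight_L a \<noteq> 0 \<or> weight_N a \<noteq> 0 \<Longrightarrow>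
      Poly_Mapping.lookup (D (basis_vec (L 0)) - sv_bracket x (basis_vec (L 0))) a = 0"
    "\<And>a. weight_L a \<noteq> 0 \<or> weight_N a \<noteq> 0 \<Longrightarrow>
      Poly_Mapping.lookup (D (basis_vec (N 0)) - sv_bracket x (basis_vec (N 0))) a = 0"
proof
  define u v where "u = D (basis_vec (L 0))" and "v = D (basis_vec (N 0))"
  \<comment> \<open>The vector \<open>x\<close> must satisfy - \<open>weight_L a\<close> *
    \<open>f a\<close> = \<open>lookup u a\<close>, and likewise with \<open>weight_N\<close> and
    \<open>v\<close>. Each coefficient is solved from whichever weight is nonzero; at joint weight
    zero the value 0 is an arbitrary choice.\<close>
  define f where "f a = (if weight_L a \<noteq> 0 then - Poly_Mapping.lookup u a / weight_L a
    else if weight_N a \<noteq> 0 then - Poly_Mapping.lookup v a / weight_N a else 0)" for a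
  \<comment> \<open>Outside these keys \<open>f\<close> vanishes, so the finite sum captures all of
    it.\<close>
  define x where "x = (\<Sum>a\<in>Poly_Mapping.keys u \<union> Poly_Mapping.keys v. Poly_Mapping.single a (f a))"
  have x: "Poly_Mapping.lookup x a = f a" for a
    by (auto simp: x_def lookup_sum lookup_single when_def f_def in_keys_iff)
  \<comment> \<open>Applying \<open>D\<close> to the vanishing bracket of \<open>L 0\<close> and
    \<open>N 0\<close> gives the compatibility that makes one \<open>x\<close> serve both
    elements.\<close>
  have "sv_bracket (basis_vec (L 0)) v = sv_bracket (basis_vec (N 0)) u"
    using derivation_add_scale(5)[OF D, of "basis_vec (L 0)" "basis_vec (N 0)"]
      sv_bracket_antisym[of u "basis_vec (N 0)"]
    by (simp add: derivation_add_scale(3)[OF D] flip: u_def v_def)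
  hence uv: "weight_L a * Poly_Mapping.lookup v a = weight_N a * Poly_Mapping.lookup u a" for a
    by (metis lookup_bracket_L0 lookup_bracket_N0)
  show "Poly_Mapping.lookup (D (basis_vec (L 0)) - sv_bracket x (basis_vec (L 0))) a = 0"
    if "weight_L a \<noteq> 0 \<or> weight_N a \<noteq> 0" for a
    using uv[of a] that unfolding sv_bracket_antisym[of x] u_def[symmetric]
    by (auto simp: lookup_add lookup_bracket_L0 x f_def)
  show "Poly_Mapping.lookup (D (basis_vec (N 0)) - sv_bracket x (basis_vec (N 0))) a = 0"
    if "weight_L a \<noteq> 0 \<or> weight_N a \<noteq> 0" for a
    using uv[of a] that unfolding sv_bracket_antisym[of x] v_def[symmetric]
    by (auto simp: lookup_add lookup_bracket_N0 x f_def field_simps)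
qed

text \<open>The bracket relations make each basis vector an eigenvector of \<open>D\<close>, with
  eigenvalue affine in the index and with the same slope \<open>d\<close> for all four
  families.\<close>

lemma derivation_normalised_inner:
  assumes D: "sv.derivation D"
    and zero_L: "\<And>a. weight_L a \<noteq> 0 \<or> weight_N a \<noteq> 0 \<Longrightarrow>
      Poly_Mapping.lookup (D (basis_vec (L 0))) a = 0"
    and zero_N: "\<And>a. weight_L a \<noteq> 0 \<or> weight_N a \<noteq> 0 \<Longrightarrow>
      Poly_Mapping.lookup (D (basis_vec (N 0))) a = 0"
  shows "sv.inner_derivation D"
proof -
  note diag_L = derivation_diag_weights[OF D basis_bracket_Cartan(1) zero_L]
  note diag_N = derivation_diag_weights[OF D basis_bracket_Cartan(2) zero_N]
  have wt: "Poly_Mapping.lookup (D (basis_vec b)) a = 0"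
    if "weight_L a \<noteq> weight_L b \<or> weight_N a \<noteq> weight_N b" for a b
    using that diag_L(2) diag_N(2) by blast
  define \<alpha> \<beta> \<gamma> \<delta> \<epsilon> \<phi> where
    coeffs: "\<alpha> n = Poly_Mapping.lookup (D (basis_vec (L n))) (L n)"
      "\<beta> n = Poly_Mapping.lookup (D (basis_vec (L n))) (N n)"
      "\<gamma> n = Poly_Mapping.lookup (D (basis_vec (N n))) (L n)"
      "\<delta> n = Poly_Mapping.lookup (D (basis_vec (N n))) (N n)"
      "\<epsilon> n = Poly_Mapping.lookup (D (basis_vec (M n))) (M n)"
      "\<phi> n = Poly_Mapping.lookup (D (basis_vec (Y n))) (Y n)" for n
  \<comment> \<open>Only \<open>L n\<close> and \<open>N n\<close> share a joint weight; those of
    \<open>M n\<close> and \<open>Y n\<close> occur once.\<close>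
  have DL: "D (basis_vec (L n)) = Poly_Mapping.single (L n) (\<alpha> n) + Poly_Mapping.single (N n) (\<beta> n)"
    and DN: "D (basis_vec (N n)) = Poly_Mapping.single (L n) (\<gamma> n) + Poly_Mapping.single (N n) (\<delta> n)"
    and DM: "D (basis_vec (M n)) = Poly_Mapping.single (M n) (\<epsilon> n)"
    and DY: "D (basis_vec (Y n)) = Poly_Mapping.single (Y n) (\<phi> n)" for n
  proof -
    show "D (basis_vec (L n)) = Poly_Mapping.single (L n) (\<alpha> n) + Poly_Mapping.single (N n) (\<beta> n)"
    proof (rule poly_mapping_eqI)
      show "Poly_Mapping.lookup (D (basis_vec (L n))) a =
          Poly_Mapping.lookup (Poly_Mapping.single (L n) (\<alpha> n) + Poly_Mapping.single (N n) (\<beta> n)) a" for a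
        using wt[of a "L n"] by (cases a) (auto simp: coeffs lookup_add lookup_single when_def)
    qed
    show "D (basis_vec (N n)) = Poly_Mapping.single (L n) (\<gamma> n) + Poly_Mapping.single (N n) (\<delta> n)"
    proof (rule poly_mapping_eqI)
      show "Poly_Mapping.lookup (D (basis_vec (N n))) a =
          Poly_Mapping.lookup (Poly_Mapping.single (L n) (\<gamma> n) + Poly_Mapping.single (N n) (\<delta> n)) a" for a
        using wt[of a "N n"] by (cases a) (auto simp: coeffs lookup_add lookup_single when_def)
    qed
    show "D (basis_vec (M n)) = Poly_Mapping.single (M n) (\<epsilon> n)"
    proof (rule poly_mapping_eqI)
      show "Poly_Mapping.lookup (D (basis_vec (M n))) a =
          Poly_Mapping.lookup (Poly_Mapping.single (M n) (\<epsilon> n)) a" for a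
        using wt[of a "M n"] by (cases a) (auto simp: coeffs lookup_single when_def)
    qed
    show "D (basis_vec (Y n)) = Poly_Mapping.single (Y n) (\<phi> n)"
    proof (rule poly_mapping_eqI)
      show "Poly_Mapping.lookup (D (basis_vec (Y n))) a =
          Poly_Mapping.lookup (Poly_Mapping.single (Y n) (\<phi> n)) a" for a
        using wt[of a "Y n"] by (cases a) (auto simp: coeffs lookup_single when_def)
    qed
  qed
  have leibniz: "D (basis_bracket a b) = sv_bracket (D (basis_vec a)) (basis_vec b) +
      sv_bracket (basis_vec a) (D (basis_vec b))" for a b
    using derivation_add_scale(5)[OF D, of "basis_vec a" "basis_vec b"] by simp
  have D_single:
      "D (Poly_Mapping.single (L n) c) =
        Poly_Mapping.single (L n) (c * \<alpha> n) + Poly_Mapping.single (N n) (c * \<beta> n)"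
      "D (Poly_Mapping.single (N n) c) =
        Poly_Mapping.single (L n) (c * \<gamma> n) + Poly_Mapping.single (N n) (c * \<delta> n)"
      "D (Poly_Mapping.single (M n) c) = Poly_Mapping.single (M n) (c * \<epsilon> n)"
      "D (Poly_Mapping.single (Y n) c) = Poly_Mapping.single (Y n) (c * \<phi> n)" for n c
    by (subst derivation_single[OF D], simp only: DL DN DM DY sv.scale_right_distrib sv_scale_single)+
  note expand = D_single sv_bilinear lookup_add lookup_single
  \<comment> \<open>The next six relations are named after the two families being bracketed; a
    suffix tells which coefficient is compared.\<close>
  have NY: "\<phi> (m + n) = \<gamma> m * (of_int n + (1 - of_int m) / 2) + \<delta> m + \<phi> n" for m n
    using arg_cong[OF leibniz[of "N m" "Y n"], of "\<lambda>x. Poly_Mapping.lookup x (Y (m + n))"]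
    by (simp add: expand)
  have NM: "2 * \<epsilon> (m + n) = \<gamma> m * of_int n + 2 * \<delta> m + 2 * \<epsilon> n" for m n
    using arg_cong[OF leibniz[of "N m" "M n"], of "\<lambda>x. Poly_Mapping.lookup x (M (m + n))"]
    by (simp add: expand algebra_simps)
  have LN_L: "of_int n * \<gamma> (m + n) = of_int (n - m) * \<gamma> n" for m n
    using arg_cong[OF leibniz[of "L m" "N n"], of "\<lambda>x. Poly_Mapping.lookup x (L (m + n))"]
    by (simp add: expand algebra_simps)
  have LN_N: "of_int n * \<delta> (m + n) = of_int n * (\<alpha> m + \<delta> n)" for m n
    using arg_cong[OF leibniz[of "L m" "N n"], of "\<lambda>x. Poly_Mapping.lookup x (N (m + n))"]
    by (simp add: expand algebra_simps)
  have LM: "of_int n * \<epsilon> (m + n) = of_int n * \<alpha> m + 2 * \<beta> m + of_int n * \<epsilon> n" for m n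
    using arg_cong[OF leibniz[of "L m" "M n"], of "\<lambda>x. Poly_Mapping.lookup x (M (m + n))"]
    by (simp add: expand algebra_simps)
  have YY: "of_int (m - n) * \<epsilon> (m + n + 1) = of_int (m - n) * (\<phi> m + \<phi> n)" for m n
    using arg_cong[OF leibniz[of "Y m" "Y n"], of "\<lambda>x. Poly_Mapping.lookup x (M (m + n + 1))"]
    by (simp add: expand algebra_simps)
  have "\<gamma> 0 = 0" "\<delta> 0 = 0"
    using diag_N(1) by (simp_all add: coeffs)
  \<comment> \<open>The first variable of \<open>LN_L\<close> is its \<open>n\<close>, so the
    instance has \<open>m\<close> = - \<open>n\<close> and reads 0 = 2 n \<gamma> n.\<close>
  have \<gamma>: "\<gamma> n = 0" for n
    using LN_L[of n "- n"] \<open>\<gamma> 0 = 0\<close> by (cases "n = 0") auto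
  \<comment> \<open>With \<gamma> gone, \<open>NY\<close> says that \<open>N m\<close> shifts \<phi>
    by \<delta> m; shifting from 0 to m + n at once or via n gives the same total.\<close>
  have \<delta>_add: "\<delta> (m + n) = \<delta> m + \<delta> n" for m n
    using NY[of "m + n" 0] NY[of m n] NY[of n 0] by (simp add: \<gamma>)
  define d where "d = \<delta> 1"
  have \<delta>: "\<delta> n = d * of_int n" for n
  proof (induction n rule: int_induct[of _ 0])
    case base
    show ?case by (simp add: \<open>\<delta> 0 = 0\<close>)
  next
    case (step1 i)
    thus ?case using \<delta>_add[of i 1] by (simp add: d_def algebra_simps)
  next
    case (step2 i)
    thus ?case using \<delta>_add[of "i - 1" 1] by (simp add: d_def algebra_simps)
  qed
  have \<alpha>: "\<alpha> n = d * of_int n" for n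
    using LN_N[of 1 n] by (simp add: \<delta> algebra_simps)
  define e where "e = \<epsilon> 0"
  have \<epsilon>: "\<epsilon> n = d * of_int n + e" for n
  proof -
    have "2 * \<epsilon> n = 2 * (d * of_int n + e)"
      using NM[of n 0] by (simp add: \<gamma> \<delta> e_def)
    thus ?thesis by (subst (asm) mult_cancel_left) simp
  qed
  \<comment> \<open>The bracket of \<open>L n\<close> with \<open>M 0\<close> vanishes, and
    \<open>LM\<close> reduces to 2 \<beta> n = 0.\<close>
  have \<beta>: "\<beta> n = 0" for n
    using LM[of 0 n] by simp
  have "\<phi> n = d * of_int n + \<phi> 0" for n
    using NY[of n 0] by (simp add: \<gamma> \<delta>)
  \<comment> \<open>The bracket of \<open>Y 1\<close> and \<open>Y 0\<close> is \<open>M 2\<close>,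
    so 2 d + e = \<phi> 1 + \<phi> 0 = d + 2 \<phi> 0.\<close>
  moreover have "\<phi> 0 = (d + e) / 2"
    using YY[of 1 0] calculation[of 1] by (simp add: \<epsilon> field_simps)
  ultimately have \<phi>: "\<phi> n = d * of_int n + (d + e) / 2" for n
    by simp
  \<comment> \<open>The factor 1/2 compensates for \<open>N 0\<close> having eigenvalue 2 on
    \<open>M n\<close>; on \<open>Y n\<close> the two terms give d (n + 1/2) + e/2, as
    required.\<close>
  let ?x = "Poly_Mapping.single (L 0) d + Poly_Mapping.single (N 0) (e / 2)"
  have "D = sv_bracket ?x"
  proof (rule sv_linear_eqI)
    show "Vector_Spaces.linear sv_scale sv_scale D" using D by (simp add: sv.derivation_def)
    show "Vector_Spaces.linear sv_scale sv_scale (sv_bracket ?x)" by (rule sv_bracket_linear_right)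
    show "D (basis_vec a) = sv_bracket ?x (basis_vec a)" for a
      unfolding sv_bracket_Cartan
      by (cases a) (simp_all add: DL DN DM DY \<alpha> \<beta> \<gamma> \<delta> \<epsilon> \<phi> field_simps)
  qed
  thus ?thesis unfolding sv.inner_derivation_def by blast
qed

lemma derivation_inner:
  assumes D: "sv.derivation D"
  shows "sv.inner_derivation D"
proof -
  obtain x where "\<And>a. weight_L a \<noteq> 0 \<or> weight_N a \<noteq> 0 \<Longrightarrow>
      Poly_Mapping.lookup (D (basis_vec (L 0)) - sv_bracket x (basis_vec (L 0))) a = 0"
    "\<And>a. weight_L a \<noteq> 0 \<or> weight_N a \<noteq> 0 \<Longrightarrow>
      Poly_Mapping.lookup (D (basis_vec (N 0)) - sv_bracket x (basis_vec (N 0))) a = 0"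
    using derivation_normalise[OF D] by blast
  hence "sv.inner_derivation (\<lambda>y. D y - sv_bracket x y)"
    by (intro derivation_normalised_inner derivation_diff_ad D)
  then obtain z where "(\<lambda>y. D y - sv_bracket x y) = sv_bracket z"
    unfolding sv.inner_derivation_def by auto
  hence "D = sv_bracket (x + z)"
    by (simp add: fun_eq_iff sv_bilinear algebra_simps)
  thus ?thesis unfolding sv.inner_derivation_def by blast
qed

theorem corollary2p11:
  "complete_lie_algebra sv_scale sv_bracket \<and> \<not> finite_dim sv_scale"
proof
  show "complete_lie_algebra sv_scale sv_bracket"
    by (intro complete_lie_algebra.intro complete_lie_algebra_axioms.intro sv.lie_algebra_axioms
      sv_center derivation_inner)
qed (rule sv_infinite_dim)

end
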